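(* Let $n,p$ be positive integers such that $n$ and $n+p$ are relatively prime. Then the set $\mathrm{LD}_{n,p}$ contains exactly $\frac{(n+p+1)(n+1)}{2}$ distinct points and is the union of the self-intersection points and the boundary points of the curve $\gamma_{n,p}$, i.e. $$\mathrm{LD}_{n,p} = \mathrm{LD}_{n,p}^{\mathrm{int}} \cup \mathrm{LD}_{n,p}^{\mathrm{out}} = \left\{ \big(z_i^{n+p}, z_j^{n}\big) :\ 0\le i\le n+p,\ 0\le j\le n,\ i+j \equiv 0 \bmod 2 \right\}.$$ The set $\mathrm{LD}_{n,p}$ can be arranged in (is the union of) the two rectangular grids $$\mathrm{LD}_{n,p}^{\mathrm{b}} := \left\{ \big(z_i^{n+p}, z_j^{n}\big) :\ 0\le i\le n+p,\ 0\le j\le n,\ i,j \text{ even} \right\},$$ $$\mathrm{LD}_{n,p}^{\mathrm{w}} := \left\{ \big(z_i^{n+p}, z_j^{n}\big) :\ 0\le i\le n+p,\ 0\le j\le n,\ i,j \text{ odd} \right\}.$$ Further, with the index sets $$\Gamma_{n,p} := \left\{(i,j)\in\mathbb{N}_0^2 :\ \tfrac{i}{n+p}+\tfrac{j}{n}<1\right\},\qquad \Gamma_{n,p}^{L} := \Gamma_{n,p}\cup\{(0,n)\},$$ the node set can be characterized as $$\mathrm{LD}_{n,p} = \left\{ \big(z_{in+j(n+p)}^{n+p},\, z_{in+j(n+p)}^{n}\big) :\ (i,j)\in \Gamma_{n,p}^{L} \right\}.$$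
   Context: The degenerate Lissajous curve is $\gamma_{n,p}:\mathbb{R}\to[-1,1]^2$, $\gamma_{n,p}(t) = (\cos(nt),\cos((n+p)t))$, considered on $[0,\pi]$. Put $t_k := \frac{\pi k}{n(n+p)}$ and $$\mathrm{LD}_{n,p} := \{\gamma_{n,p}(t_k) : k = 0,\ldots,n(n+p)\}.$$ For $m\in\mathbb{N}$ and an integer $k\ge 0$, $z_k^{m} := \cos\left(\frac{k\pi}{m}\right)$. $\mathrm{LD}_{n,p}^{\mathrm{int}} := \{(z_i^{n+p},z_j^n): 1\le i\le n+p-1,\ 1\le j\le n-1,\ i+j\equiv 0 \bmod 2\}$. This is known to be the set of self-intersection points of $\gamma_{n,p}|_{[0,\pi]}$ in the interior of the square $[-1,1]^2$, i.e. the points $\gamma_{n,p}(t)=\gamma_{n,p}(t')$ with $t\neq t'$ in $[0,\pi]$. $\mathrm{LD}_{n,p}^{\mathrm{out}} := \{(z_i^{n+p},z_j^n): 0\le i\le n+p,\ j\in\{0,n\},\ i+j\equiv 0 \bmod 2\}\cup\{(z_i^{n+p},z_j^n): i\in\{0,n+p\},\ 1\le j\le n-1,\ i+j\equiv 0\bmod 2\}$. This is the set of points at which $\gamma_{n,p}$ touches the boundary of $[-1,1]^2$. *)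

theory Defs
  imports "HOL-Analysis.Analysis"
begin

definition lissajous :: "nat \<Rightarrow> nat \<Rightarrow> real \<Rightarrow> real \<times> real" where
  "lissajous n p t = (cos (real n * t), cos (real (n + p) * t))"

definition sample_time :: "nat \<Rightarrow> nat \<Rightarrow> nat \<Rightarrow> real" where
  "sample_time n p k = pi * real k / (real n * real (n + p))"

definition LD :: "nat \<Rightarrow> nat \<Rightarrow> (real \<times> real) set" where
  "LD n p = {lissajous n p (sample_time n p k) | k. k \<le> n * (n + p)}"

(* z_k^m, with the upper index as first argument *)
definition zcos :: "nat \<Rightarrow> nat \<Rightarrow> real" where
  "zcos m k = cos (real k * pi / real m)"

definition square :: "(real \<times> real) set" where
  "square = {-1..1} \<times> {-1..1}"

definition self_intersection_points :: "nat \<Rightarrow> nat \<Rightarrow> (real \<times> real) set" where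
  "self_intersection_points n p =
     {q \<in> interior square. \<exists>t\<in>{0..pi}. \<exists>t'\<in>{0..pi}.
        t \<noteq> t' \<and> lissajous n p t = q \<and> lissajous n p t' = q}"

definition boundary_points :: "nat \<Rightarrow> nat \<Rightarrow> (real \<times> real) set" where
  "boundary_points n p = lissajous n p ` {0..pi} \<inter> frontier square"

definition LD_int :: "nat \<Rightarrow> nat \<Rightarrow> (real \<times> real) set" where
  "LD_int n p = {(zcos (n + p) i, zcos n j) | i j.
     1 \<le> i \<and> i \<le> n + p - 1 \<and> 1 \<le> j \<and> j \<le> n - 1 \<and> even (i + j)}"

definition LD_out :: "nat \<Rightarrow> nat \<Rightarrow> (real \<times> real) set" where
  "LD_out n p =
     {(zcos (n + p) i, zcos n j) | i j. i \<le> n + p \<and> j \<in> {0, n} \<and> even (i + j)} \<union>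
     {(zcos (n + p) i, zcos n j) | i j. i \<in> {0, n + p} \<and> 1 \<le> j \<and> j \<le> n - 1 \<and> even (i + j)}"

definition LD_b :: "nat \<Rightarrow> nat \<Rightarrow> (real \<times> real) set" where
  "LD_b n p = {(zcos (n + p) i, zcos n j) | i j. i \<le> n + p \<and> j \<le> n \<and> even i \<and> even j}"

definition LD_w :: "nat \<Rightarrow> nat \<Rightarrow> (real \<times> real) set" where
  "LD_w n p = {(zcos (n + p) i, zcos n j) | i j. i \<le> n + p \<and> j \<le> n \<and> odd i \<and> odd j}"

definition Gamma_idx :: "nat \<Rightarrow> nat \<Rightarrow> (nat \<times> nat) set" where
  "Gamma_idx n p = {(i, j). real i / real (n + p) + real j / real n < 1}"

definition Gamma_idx_L :: "nat \<Rightarrow> nat \<Rightarrow> (nat \<times> nat) set" where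
  "Gamma_idx_L n p = Gamma_idx n p \<union> {(0, n)}"

end

theory Submission
  imports Defs
begin

text \<open>
  With \<open>m = n + p\<close>, the \<open>k\<close>-th sample point is \<open>(cos (k\<pi>/m), cos (k\<pi>/n))\<close>, which depends only on
  \<open>k\<close> up to sign modulo \<open>2m\<close> in the first coordinate and modulo \<open>2n\<close> in the second. Folding \<open>k\<close>
  into \<open>[0, m]\<close> and \<open>[0, n]\<close> preserves parity, and the Chinese remainder theorem for the moduli
  \<open>2m\<close>, \<open>2n\<close> (whose gcd is 2) recovers \<open>k\<close> from every pair \<open>(i, j)\<close> of equal parity. The two sign
  choices \<open>(i, j)\<close> and \<open>(i, -j)\<close> give the two parameters of a self-intersection. For the index set
  \<open>\<Gamma>\<close>, every \<open>k\<close> is an integer combination \<open>i n + j m\<close>; flipping the sign of \<open>j\<close>, or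
  replacing \<open>(i, j)\<close> by \<open>(m - i, n - j)\<close>, does not move the point.
\<close>

section \<open>Cosine nodes up to shift and sign of the index\<close>

text \<open>Integer indices make room for the negative values that Bezout and the Chinese remainder
  theorem produce.\<close>

definition icos :: "nat \<Rightarrow> int \<Rightarrow> real" where
  "icos m k = cos (real_of_int k * pi / real m)"

lemma zcos_eq_icos: "zcos m k = icos m (int k)"
  by (simp add: zcos_def icos_def)

lemma icos_eq_iff:
  assumes "m > 0"
  shows "icos m k = icos m l \<longleftrightarrow> 2 * int m dvd k - l \<or> 2 * int m dvd k + l"
proof -
  have lin: "real_of_int k * pi / real m = c * (real_of_int l * pi / real m) + 2 * real_of_int z * pi
      \<longleftrightarrow> real_of_int k = c * real_of_int l + 2 * real m * real_of_int z" for c :: real and z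
  proof -
    have "c * (real_of_int l * pi / real m) + 2 * real_of_int z * pi
        = (c * real_of_int l + 2 * real m * real_of_int z) * pi / real m"
      using assms by (simp add: field_simps)
    then show ?thesis using assms by simp
  qed
  have int: "(\<exists>z. real_of_int k = real_of_int c * real_of_int l + 2 * real m * real_of_int z)
      \<longleftrightarrow> 2 * int m dvd k - c * l" for c
  proof -
    have "real_of_int k = real_of_int c * real_of_int l + 2 * real m * real_of_int z
        \<longleftrightarrow> k - c * l = 2 * int m * z" for z
    proof -
      have "real_of_int k = real_of_int c * real_of_int l + 2 * real m * real_of_int z
        \<longleftrightarrow> real_of_int k = real_of_int (c * l + 2 * int m * z)" by simp
      also have "\<dots> \<longleftrightarrow> k - c * l = 2 * int m * z"
        unfolding of_int_eq_iff by auto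
      finally show ?thesis .
    qed
    then show ?thesis by (auto simp: dvd_def)
  qed
  have "icos m k = icos m l \<longleftrightarrow>
      (\<exists>z. real_of_int k * pi / real m = 1 * (real_of_int l * pi / real m) + 2 * real_of_int z * pi) \<or>
      (\<exists>z. real_of_int k * pi / real m = - 1 * (real_of_int l * pi / real m) + 2 * real_of_int z * pi)"
    unfolding icos_def cos_eq Ints_def by auto
  also have "\<dots> \<longleftrightarrow> 2 * int m dvd k - l \<or> 2 * int m dvd k + l"
    unfolding lin using int[of 1] int[of "-1"] by simp
  finally show ?thesis .
qed

text \<open>Reduce \<open>k\<close> to \<open>r\<close> in \<open>[0, 2m)\<close>; if
  \<open>r\<close> exceeds \<open>m\<close>, then \<open>2m - r\<close> lies in range and is
  congruent to \<open>-k\<close>. The divisibility form serves both for folding a coordinate and for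
  folding the sample index itself.\<close>

lemma fold_index:
  assumes "m > 0"
  obtains i where "i \<le> m" "2 * int m dvd int i - k \<or> 2 * int m dvd int i + k"
proof -
  define r where "r = k mod (2 * int m)"
  have r: "0 \<le> r" "r < 2 * int m" "2 * int m dvd r - k"
    using assms by (simp_all add: r_def mod_eq_dvd_iff[symmetric])
  show ?thesis
  proof (cases "r \<le> int m")
    case True
    then have "nat r \<le> m" "int (nat r) - k = r - k" using r by simp_all
    then show ?thesis using that[of "nat r"] r(3) by presburger
  next
    case False
    have "2 * int m dvd 2 * int m - (r - k)" using r(3) by (rule dvd_diff[OF dvd_refl])
    moreover have "nat (2 * int m - r) \<le> m" "int (nat (2 * int m - r)) + k = 2 * int m - (r - k)"
      using r False by simp_all
    ultimately show ?thesis using that[of "nat (2 * int m - r)"] by presburger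
  qed
qed

lemma zcos_fold:
  assumes "m > 0"
  obtains i where "i \<le> m" "even i \<longleftrightarrow> even k" "zcos m i = icos m k"
proof -
  obtain i where i: "i \<le> m" "2 * int m dvd int i - k \<or> 2 * int m dvd int i + k"
    using fold_index[OF assms] by blast
  \<comment> \<open>The modulus \<open>2 * m\<close> is even, so neither the shift nor the sign
    changes parity.\<close>
  have "even (int i - k) \<or> even (int i + k)" using i(2) by (metis dvd_mult_left)
  then have "even i \<longleftrightarrow> even k" by auto
  with i show ?thesis using that[of i] assms by (auto simp: zcos_eq_icos icos_eq_iff)
qed

text \<open>The moduli have gcd 2, so equal parity of the two residues is the solvability condition;
  Bezout for the halved moduli, applied to half of \<open>i - j\<close>, gives a solution.\<close>

lemma crt_same_parity:
  fixes i j :: int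
  assumes "coprime n m" "even (i - j)"
  obtains k where "2 * int m dvd k - i" "2 * int n dvd k - j"
proof -
  have "coprime (int m) (int n)" using assms(1) by (simp add: coprime_commute)
  then obtain u v where uv: "u * int m + v * int n = 1"
    using bezout_int[of "int m" "int n"] by auto
  obtain d where d: "i - j = 2 * d" using assms(2) by blast
  define k where "k = i - 2 * int m * (u * d)"
  have "k - j = 2 * d * (1 - u * int m)" using d by (simp add: k_def algebra_simps)
  also have "1 - u * int m = v * int n" using uv by simp
  finally have "2 * int n dvd k - j" by simp
  moreover have "2 * int m dvd k - i" by (simp add: k_def)
  ultimately show ?thesis using that by blast
qed

section \<open>Position of the nodes relative to the square\<close>

lemma zcos_interior: "0 < k \<Longrightarrow> k < m \<Longrightarrow> - 1 < zcos m k \<and> zcos m k < 1"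
  using cos_monotone_0_pi[of 0 "real k * pi / real m"]
    cos_monotone_0_pi[of "real k * pi / real m" pi]
  by (simp add: zcos_def field_simps)

lemma zcos_0: "zcos m 0 = 1"
  by (simp add: zcos_def)

lemma zcos_self: "m > 0 \<Longrightarrow> zcos m m = - 1"
  by (simp add: zcos_def)

lemma zcos_inj_on: "m > 0 \<Longrightarrow> inj_on (zcos m) {..m}"
  unfolding inj_on_def zcos_def
  by (auto dest!: cos_inj_pi[rotated 4] simp: field_simps)

lemma interior_square: "interior square = {-1<..<1} \<times> {-1<..<1}"
  by (simp add: square_def interior_Times)

lemma frontier_square: "frontier square = square - {-1<..<1} \<times> {-1<..<1}"
proof -
  have "closed square" by (simp add: square_def closed_Times)
  then show ?thesis by (simp add: frontier_def interior_square)
qed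

section \<open>Sample points as pairs of cosine nodes\<close>

lemma lissajous_sample_time:
  assumes "n > 0"
  shows "lissajous n p (sample_time n p k) = (zcos (n + p) k, zcos n k)"
proof -
  have "real n * sample_time n p k = real k * pi / real (n + p)"
    "real (n + p) * sample_time n p k = real k * pi / real n"
    using assms by (simp_all add: sample_time_def del: of_nat_add)
  then show ?thesis by (simp only: lissajous_def zcos_def)
qed

lemma sample_time_bounds:
  assumes "n > 0" "k \<le> n * (n + p)"
  shows "sample_time n p k \<in> {0..pi}"
proof -
  have "real k \<le> real n * real (n + p)" using assms(2) by (metis of_nat_le_iff of_nat_mult)
  then show ?thesis using assms(1) by (simp add: sample_time_def pos_divide_le_eq)
qed

lemma sample_time_eq_iff: "n > 0 \<Longrightarrow> sample_time n p k = sample_time n p l \<longleftrightarrow> k = l"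
  by (simp add: sample_time_def)

lemma LD_eq:
  assumes "n > 0"
  shows "LD n p = {(zcos (n + p) k, zcos n k) | k. k \<le> n * (n + p)}"
  using lissajous_sample_time[OF assms] by (simp add: LD_def)

text \<open>Both \<open>2 * n\<close> and \<open>2 * (n + p)\<close> divide
  \<open>2 * n * (n + p)\<close>, so one folding modulo the latter preserves both coordinates at
  once. The congruence is kept in the conclusion because it later tells two parameters
  apart.\<close>

lemma sample_index_fold:
  assumes "n > 0"
  obtains l where "l \<le> n * (n + p)"
    "2 * int (n * (n + p)) dvd int l - k \<or> 2 * int (n * (n + p)) dvd int l + k"
    "zcos (n + p) l = icos (n + p) k" "zcos n l = icos n k"
proof -
  obtain l where l: "l \<le> n * (n + p)"
    "2 * int (n * (n + p)) dvd int l - k \<or> 2 * int (n * (n + p)) dvd int l + k"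
    using fold_index[of "n * (n + p)" k] assms by auto
  have "2 * int (n + p) dvd 2 * int (n * (n + p))" "2 * int n dvd 2 * int (n * (n + p))"
    by (simp_all only: of_nat_mult mult_dvd_mono dvd_triv_left dvd_triv_right dvd_refl)
  then have "2 * int (n + p) dvd int l - k \<or> 2 * int (n + p) dvd int l + k"
    "2 * int n dvd int l - k \<or> 2 * int n dvd int l + k"
    using l(2) dvd_trans by blast+
  then show ?thesis using that[of l] l assms by (simp add: zcos_eq_icos icos_eq_iff)
qed

lemma icos_pair_in_LD:
  assumes "n > 0"
  shows "(icos (n + p) k, icos n k) \<in> LD n p"
proof -
  obtain l where "l \<le> n * (n + p)" "zcos (n + p) l = icos (n + p) k" "zcos n l = icos n k"
    using sample_index_fold[OF assms] by blast
  then show ?thesis unfolding LD_eq[OF assms] by (metis (mono_tags, lifting) mem_Collect_eq)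
qed

text \<open>Common exit for boundary points and self-intersections: for both,
  \<open>n * (n + p) * t\<close> turns out to be an integer multiple of \<pi>.\<close>

lemma lissajous_in_LD:
  assumes "n > 0" "real n * real (n + p) * t = real_of_int k * pi"
  shows "lissajous n p t \<in> LD n p"
proof -
  have "real n * t = real_of_int k * pi / real (n + p)" "real (n + p) * t = real_of_int k * pi / real n"
    using assms by (simp_all add: field_simps)
  then have "lissajous n p t = (icos (n + p) k, icos n k)"
    by (simp add: lissajous_def icos_def)
  then show ?thesis using icos_pair_in_LD[OF assms(1)] by simp
qed

section \<open>The parity grid: equality with the sample set, counting, decompositions\<close>

definition node_index :: "nat \<Rightarrow> nat \<Rightarrow> (nat \<times> nat) set" where
  "node_index m n = {(i, j). i \<le> m \<and> j \<le> n \<and> even (i + j)}"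

definition nodes :: "nat \<Rightarrow> nat \<Rightarrow> (real \<times> real) set" where
  "nodes m n = {(zcos m i, zcos n j) | i j. i \<le> m \<and> j \<le> n \<and> even (i + j)}"

lemma nodesI:
  "i \<le> m \<Longrightarrow> j \<le> n \<Longrightarrow> even (i + j) \<Longrightarrow> (zcos m i, zcos n j) \<in> nodes m n"
  unfolding nodes_def by blast

lemma nodes_eq_image: "nodes m n = map_prod (zcos m) (zcos n) ` node_index m n"
  by (auto simp: nodes_def node_index_def)

text \<open>Forwards, each coordinate is folded separately and both new indices inherit the parity
  of \<open>k\<close>. Backwards, the Chinese remainder theorem supplies one index for both
  coordinates.\<close>

lemma LD_eq_nodes:
  assumes "n > 0" "coprime n (n + p)"
  shows "LD n p = nodes (n + p) n"
proof (intro Set.equalityI subsetI)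
  fix q assume "q \<in> LD n p"
  then obtain k where q: "q = (zcos (n + p) k, zcos n k)" using LD_eq[OF assms(1)] by blast
  obtain i where i: "i \<le> n + p" "even i \<longleftrightarrow> even (int k)" "zcos (n + p) i = icos (n + p) (int k)"
    using zcos_fold[of "n + p" "int k"] assms by auto
  obtain j where j: "j \<le> n" "even j \<longleftrightarrow> even (int k)" "zcos n j = icos n (int k)"
    using zcos_fold[of n "int k"] assms by auto
  have "q = (zcos (n + p) i, zcos n j)" "even (i + j)"
    using i j by (simp_all add: q zcos_eq_icos)
  then show "q \<in> nodes (n + p) n" using i(1) j(1) unfolding nodes_def by blast
next
  fix q assume "q \<in> nodes (n + p) n"
  then obtain i j where q: "q = (zcos (n + p) i, zcos n j)" and ev: "even (i + j)"
    by (auto simp: nodes_def)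
  have "even (int i - int j)" using ev by simp
  then obtain k where "2 * int (n + p) dvd k - int i" "2 * int n dvd k - int j"
    using crt_same_parity[OF assms(2)] by blast
  then have "q = (icos (n + p) k, icos n k)"
    unfolding q zcos_eq_icos using assms(1) icos_eq_iff[of "n + p" k "int i"] icos_eq_iff[of n k "int j"]
    by auto
  then show "q \<in> LD n p" using icos_pair_in_LD[OF assms(1)] by simp
qed

text \<open>Coprimality excludes that \<open>m\<close> and \<open>n\<close> are both even, so some
  reflection exchanges the pairs with even sum and those with odd sum.\<close>

lemma card_node_index:
  assumes "coprime n m"
  shows "2 * card (node_index m n) = (m + 1) * (n + 1)"
proof -
  let ?odd = "{..m} \<times> {..n} - node_index m n"
  \<comment> \<open>Reflecting a coordinate whose range has odd length flips the parity of \<open>i + j\<close>.\<close>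
  have "\<exists>f. bij_betw f (node_index m n) ?odd"
  proof (cases "odd m")
    case True
    then have "bij_betw (\<lambda>(i, j). (m - i, j)) (node_index m n) ?odd"
      by (intro bij_betw_byWitness[where f' = "\<lambda>(i, j). (m - i, j)"])
        (auto simp: node_index_def)
    then show ?thesis by blast
  next
    case False
    then have "odd n" using assms by (metis coprime_common_divisor odd_one)
    then have "bij_betw (\<lambda>(i, j). (i, n - j)) (node_index m n) ?odd"
      by (intro bij_betw_byWitness[where f' = "\<lambda>(i, j). (i, n - j)"])
        (auto simp: node_index_def)
    then show ?thesis by blast
  qed
  then have "card (node_index m n) = card ?odd" using bij_betw_same_card by blast
  moreover have sub: "node_index m n \<subseteq> {..m} \<times> {..n}" by (auto simp: node_index_def)
  then have "card ({..m} \<times> {..n}) = card (node_index m n) + card ?odd"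
    by (metis card_Diff_subset card_mono finite_SigmaI finite_atMost finite_subset
        le_add_diff_inverse)
  ultimately show ?thesis by (simp add: card_cartesian_product)
qed

lemma card_nodes:
  assumes "n > 0" "m > 0" "coprime n m"
  shows "real (card (nodes m n)) = real ((m + 1) * (n + 1)) / 2"
proof -
  have "inj_on (map_prod (zcos m) (zcos n)) ({..m} \<times> {..n})"
    using zcos_inj_on assms(1,2) by (intro map_prod_inj_on) auto
  then have "inj_on (map_prod (zcos m) (zcos n)) (node_index m n)"
    by (rule inj_on_subset) (auto simp: node_index_def)
  then have "card (nodes m n) = card (node_index m n)"
    unfolding nodes_eq_image by (rule card_image)
  then show ?thesis using card_node_index[OF assms(3)] by (simp flip: of_nat_mult)
qed

lemma nodes_eq_LD_int_out: "n > 0 \<Longrightarrow> nodes (n + p) n = LD_int n p \<union> LD_out n p"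
proof (intro Set.equalityI subsetI)
  fix q assume "n > 0" "q \<in> nodes (n + p) n"
  then obtain i j where ij: "q = (zcos (n + p) i, zcos n j)" "i \<le> n + p" "j \<le> n" "even (i + j)"
    by (auto simp: nodes_def)
  \<comment> \<open>Horizontal edges with corners, vertical edges without corners, interior.\<close>
  consider "j \<in> {0, n}" | "i \<in> {0, n + p}" "1 \<le> j" "j \<le> n - 1"
    | "1 \<le> i" "i \<le> n + p - 1" "1 \<le> j" "j \<le> n - 1"
    using ij(2,3) by force
  then show "q \<in> LD_int n p \<union> LD_out n p"
    using ij unfolding LD_int_def LD_out_def by cases blast+
next
  fix q assume "n > 0" "q \<in> LD_int n p \<union> LD_out n p"
  then show "q \<in> nodes (n + p) n"
    by (auto simp: LD_int_def LD_out_def intro: nodesI)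
qed

lemma nodes_eq_LD_b_w: "nodes (n + p) n = LD_b n p \<union> LD_w n p"
  unfolding nodes_def LD_b_def LD_w_def by auto

section \<open>Boundary points and self-intersections of the curve\<close>

text \<open>On the boundary one cosine is 1 or -1, so its argument is a multiple of \<pi>;
  multiplying by the other frequency finishes.\<close>

lemma boundary_points_subset_LD:
  assumes "n > 0"
  shows "boundary_points n p \<subseteq> LD n p"
proof
  fix q assume "q \<in> boundary_points n p"
  then obtain t where q: "q = lissajous n p t" and fr: "lissajous n p t \<in> frontier square"
    by (auto simp: boundary_points_def)
  have abs1: "\<bar>cos x\<bar> = 1" if "\<not> (- 1 < cos x \<and> cos x < 1)" for x :: real
    using that cos_ge_minus_one[of x] cos_le_one[of x] by linarith
  have sin_zero: "sin x = 0" if "\<bar>cos x\<bar> = 1" for x :: real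
    using that sin_cos_squared_add[of x] by (simp flip: abs_square_eq_1)
  have "\<bar>cos (real n * t)\<bar> = 1 \<or> \<bar>cos (real (n + p) * t)\<bar> = 1"
    using fr abs1 unfolding frontier_square lissajous_def by fastforce
  then have "sin (real n * t) = 0 \<or> sin (real (n + p) * t) = 0"
    using sin_zero by blast
  then obtain z where "real n * t = real_of_int z * pi \<or> real (n + p) * t = real_of_int z * pi"
    unfolding sin_zero_iff_int2 by blast
  then have "real n * real (n + p) * t = real_of_int (int (n + p) * z) * pi
      \<or> real n * real (n + p) * t = real_of_int (int n * z) * pi"
  proof (rule disj_forward)
    assume z: "real n * t = real_of_int z * pi"
    have "real n * real (n + p) * t = real (n + p) * (real n * t)" by simp
    then show "real n * real (n + p) * t = real_of_int (int (n + p) * z) * pi" unfolding z by simp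
  next
    assume z: "real (n + p) * t = real_of_int z * pi"
    have "real n * real (n + p) * t = real n * (real (n + p) * t)" by simp
    then show "real n * real (n + p) * t = real_of_int (int n * z) * pi" unfolding z by simp
  qed
  then show "q \<in> LD n p" unfolding q using lissajous_in_LD[OF assms] by blast
qed

lemma two_pi_multiple:
  assumes "n > 0" "coprime n m"
    and "real n * s = 2 * real_of_int a * pi" "real m * s = 2 * real_of_int b * pi"
  obtains c where "s = 2 * real_of_int c * pi"
proof -
  have "real m * (real n * s) = real n * (real m * s)" by simp
  then have "(2 * pi) * real_of_int (int m * a) = (2 * pi) * real_of_int (int n * b)"
    unfolding assms(3,4) by (simp add: algebra_simps)
  then have "real_of_int (int m * a) = real_of_int (int n * b)" by (subst (asm) mult_cancel_left) simp
  then have "int m * a = int n * b" unfolding of_int_eq_iff .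
  then have "int n dvd int m * a" by simp
  then have "int n dvd a" using assms(2) by (simp add: coprime_dvd_mult_right_iff)
  then obtain c where "a = int n * c" by blast
  then have "s = 2 * real_of_int c * pi" using assms(1,3) by simp
  then show ?thesis using that by blast
qed

text \<open>Equality in each coordinate makes its frequency times \<open>t - t'\<close> or
  \<open>t + t'\<close> a multiple of 2\<pi>. The same choice in both coordinates would, by
  coprimality, make that number itself a multiple of 2\<pi>. So the choices differ, and
  \<open>(t - t') + (t + t') = 2 * t\<close> yields the claim.\<close>

lemma self_intersection_in_LD:
  assumes "n > 0" "coprime n (n + p)" "t \<in> {0..pi}" "t' \<in> {0..pi}" "t \<noteq> t'"
    and eq: "lissajous n p t = lissajous n p t'"
  shows "lissajous n p t \<in> LD n p"
proof -
  let ?m = "n + p"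
  have "cos (real n * t) = cos (real n * t')" using eq by (simp add: lissajous_def)
  then obtain a where a: "real n * (t - t') = 2 * real_of_int a * pi \<or> real n * (t + t') = 2 * real_of_int a * pi"
    unfolding cos_eq Ints_def by (auto simp: algebra_simps)
  have "cos (real ?m * t) = cos (real ?m * t')" using eq by (simp add: lissajous_def)
  then obtain b where b: "real ?m * (t - t') = 2 * real_of_int b * pi \<or> real ?m * (t + t') = 2 * real_of_int b * pi"
    unfolding cos_eq Ints_def by (auto simp: algebra_simps)
  \<comment> \<open>Distinct points of \<open>[0, \<pi>]\<close> have a nonzero difference and a
    nonzero sum, both below 2\<pi> in absolute value.\<close>
  have no_period: False if "s = t - t' \<or> s = t + t'" "s = 2 * real_of_int c * pi" for s c
  proof -
    have "\<bar>s\<bar> < 2 * pi" "s \<noteq> 0" using that(1) assms(3-5) pi_gt_zero by auto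
    then have "\<bar>real_of_int c\<bar> < 1" "c \<noteq> 0" using that(2) by (auto simp: abs_mult)
    then show False by linarith
  qed
  have "\<exists>x y. real n * x = 2 * real_of_int a * pi \<and> real ?m * y = 2 * real_of_int b * pi \<and> x + y = 2 * t"
  proof -
    have "\<not> (real n * s = 2 * real_of_int a * pi \<and> real ?m * s = 2 * real_of_int b * pi)"
      if "s = t - t' \<or> s = t + t'" for s
      using no_period[OF that] two_pi_multiple[OF assms(1,2)] by metis
    then have "real n * (t - t') = 2 * real_of_int a * pi \<and> real ?m * (t + t') = 2 * real_of_int b * pi
      \<or> real n * (t + t') = 2 * real_of_int a * pi \<and> real ?m * (t - t') = 2 * real_of_int b * pi"
      using a b by blast
    then show ?thesis
    proof
      assume "real n * (t - t') = 2 * real_of_int a * pi \<and> real ?m * (t + t') = 2 * real_of_int b * pi"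
      then show ?thesis by (intro exI[of _ "t - t'"] exI[of _ "t + t'"]) argo
    next
      assume "real n * (t + t') = 2 * real_of_int a * pi \<and> real ?m * (t - t') = 2 * real_of_int b * pi"
      then show ?thesis by (intro exI[of _ "t + t'"] exI[of _ "t - t'"]) argo
    qed
  qed
  then obtain x y where x: "real n * x = 2 * real_of_int a * pi"
    and y: "real ?m * y = 2 * real_of_int b * pi" and xy: "x + y = 2 * t" by blast
  have "2 * (real n * real ?m * t) = real n * real ?m * (x + y)" unfolding xy by simp
  also have "\<dots> = real ?m * (real n * x) + real n * (real ?m * y)" by (simp add: algebra_simps)
  also have "\<dots> = 2 * (real_of_int (int ?m * a + int n * b) * pi)"
    unfolding x y by (simp add: algebra_simps)
  finally have "real n * real ?m * t = real_of_int (int ?m * a + int n * b) * pi" by simp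
  then show ?thesis using lissajous_in_LD[OF assms(1)] by blast
qed

text \<open>Congruence up to sign is transitive through \<open>x\<close>.\<close>

lemma dvd_diff_or_add:
  fixes d x k k' :: int
  assumes "d dvd x - k \<or> d dvd x + k" "d dvd x - k' \<or> d dvd x + k'"
  shows "d dvd k - k' \<or> d dvd k + k'"
proof -
  have "k - k' = (x - k') - (x - k)" "k - k' = (x + k) - (x + k')"
    "k + k' = (x + k') - (x - k)" "k + k' = (x + k) - (x - k')" by simp_all
  then show ?thesis using assms by (metis dvd_diff)
qed

text \<open>The residue pairs \<open>(i, j)\<close> and \<open>(i, -j)\<close> describe the same
  point but lead to indices \<open>k\<close> and \<open>k'\<close> that fold to different sample
  indices.\<close>

lemma LD_int_subset_self_intersection_points:
  assumes "n > 0" "coprime n (n + p)"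
  shows "LD_int n p \<subseteq> self_intersection_points n p"
proof
  fix q assume "q \<in> LD_int n p"
  let ?m = "n + p"
  obtain i j where q: "q = (zcos ?m i, zcos n j)"
    and ij: "0 < i" "i < ?m" "0 < j" "j < n" "even (i + j)"
    using \<open>q \<in> LD_int n p\<close> by (force simp: LD_int_def)
  have "even (int i - int j)" "even (int i - - int j)" using ij(5) by simp_all
  then obtain k k' where k: "2 * int ?m dvd k - int i" "2 * int n dvd k - int j"
    and k': "2 * int ?m dvd k' - int i" "2 * int n dvd k' - - int j"
    using crt_same_parity[OF assms(2)] by metis
  have qk: "q = (icos ?m k, icos n k)" "q = (icos ?m k', icos n k')"
    using k k' assms(1) icos_eq_iff[of ?m k "int i"] icos_eq_iff[of n k "int j"]
      icos_eq_iff[of ?m k' "int i"] icos_eq_iff[of n k' "int j"]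
    unfolding q zcos_eq_icos by auto
  obtain l where l: "l \<le> n * ?m" "2 * int (n * ?m) dvd int l - k \<or> 2 * int (n * ?m) dvd int l + k"
    "zcos ?m l = icos ?m k" "zcos n l = icos n k"
    using sample_index_fold[OF assms(1)] by blast
  obtain l' where l': "l' \<le> n * ?m" "2 * int (n * ?m) dvd int l' - k' \<or> 2 * int (n * ?m) dvd int l' + k'"
    "zcos ?m l' = icos ?m k'" "zcos n l' = icos n k'"
    using sample_index_fold[OF assms(1)] by blast
  have "l \<noteq> l'"
  proof
    assume "l = l'"
    with l(2) l'(2) have "2 * int (n * ?m) dvd k - k' \<or> 2 * int (n * ?m) dvd k + k'"
      using dvd_diff_or_add by blast
    \<comment> \<open>Modulo \<open>2 * n\<close> the difference \<open>k - k'\<close> is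
      \<open>2 * j\<close>; modulo \<open>2 * (n + p)\<close> the sum is \<open>2 * i\<close>.
      Neither vanishes for an interior node.\<close>
    then show False
    proof
      assume "2 * int (n * ?m) dvd k - k'"
      then have "2 * int n dvd k - k'" by (rule dvd_trans[rotated]) simp
      then have "2 * int n dvd (k' - - int j) - (k - int j) + (k - k')"
        by (rule dvd_add[OF dvd_diff[OF k'(2) k(2)]])
      then have "2 * int n dvd 2 * int j" by simp
      then have "n dvd j" by simp
      then show False using ij by (simp add: nat_dvd_not_less)
    next
      assume "2 * int (n * ?m) dvd k + k'"
      moreover have "2 * int ?m dvd 2 * int (n * ?m)"
        by (simp only: of_nat_mult mult_dvd_mono dvd_triv_right dvd_refl)
      ultimately have "2 * int ?m dvd k + k'" by (rule dvd_trans[rotated])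
      then have "2 * int ?m dvd (k + k') - (k' - int i) - (k - int i)"
        by (rule dvd_diff[OF dvd_diff[OF _ k'(1)] k(1)])
      then have "2 * int ?m dvd 2 * int i" by simp
      then have "?m dvd i" by (metis dvd_mult_cancel_left int_dvd_int_iff zero_neq_numeral)
      then show False using ij by (simp add: nat_dvd_not_less)
    qed
  qed
  then have "sample_time n p l \<noteq> sample_time n p l'" using sample_time_eq_iff assms(1) by blast
  moreover have "lissajous n p (sample_time n p l) = q" "lissajous n p (sample_time n p l') = q"
    using l l' qk by (simp_all add: lissajous_sample_time assms(1))
  moreover have "q \<in> interior square"
    using zcos_interior ij by (simp add: q interior_square)
  ultimately show "q \<in> self_intersection_points n p"
    using sample_time_bounds[OF assms(1)] l(1) l'(1) unfolding self_intersection_points_def by blast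
qed

lemma LD_out_subset_frontier:
  assumes "n > 0"
  shows "LD_out n p \<subseteq> frontier square"
proof -
  have "zcos m k \<in> {-1..1}" for m k by (simp add: zcos_def)
  then show ?thesis using assms unfolding frontier_square by (auto simp: square_def LD_out_def zcos_0 zcos_self)
qed

lemma LD_subset_curve: "n > 0 \<Longrightarrow> LD n p \<subseteq> lissajous n p ` {0..pi}"
  using sample_time_bounds by (auto simp: LD_def)

lemma LD_eq_self_intersection_boundary:
  assumes "n > 0" "coprime n (n + p)"
  shows "LD n p = self_intersection_points n p \<union> boundary_points n p"
proof (intro Set.equalityI subsetI)
  fix q assume q: "q \<in> LD n p"
  then consider "q \<in> LD_int n p" | "q \<in> LD_out n p"
    using LD_eq_nodes[OF assms] nodes_eq_LD_int_out[OF assms(1)] by blast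
  then show "q \<in> self_intersection_points n p \<union> boundary_points n p"
  proof cases
    case 1
    then show ?thesis using LD_int_subset_self_intersection_points[OF assms] by blast
  next
    case 2
    then have "q \<in> frontier square" using LD_out_subset_frontier[OF assms(1)] by blast
    moreover have "q \<in> lissajous n p ` {0..pi}" using LD_subset_curve[OF assms(1)] q by blast
    ultimately show ?thesis by (simp add: boundary_points_def)
  qed
next
  fix q assume "q \<in> self_intersection_points n p \<union> boundary_points n p"
  then show "q \<in> LD n p"
    using boundary_points_subset_LD[OF assms(1)] self_intersection_in_LD[OF assms]
    by (auto simp: self_intersection_points_def)
qed

section \<open>Characterisation by the index set \<Gamma>\<close>

lemma Gamma_idx_iff:
  assumes "n > 0"
  shows "(i, j) \<in> Gamma_idx n p \<longleftrightarrow> i * n + j * (n + p) < n * (n + p)"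
proof -
  have "real i / real (n + p) + real j / real n = real (i * n + j * (n + p)) / real (n * (n + p))"
    using assms by (simp add: field_simps)
  moreover have "real (n * (n + p)) > 0" using assms by simp
  ultimately have "(i, j) \<in> Gamma_idx n p \<longleftrightarrow> real (i * n + j * (n + p)) < real (n * (n + p))"
    by (simp add: Gamma_idx_def del: of_nat_mult of_nat_add)
  then show ?thesis by (simp only: of_nat_less_iff)
qed

text \<open>Reduce the Bezout coefficient of \<open>n\<close> modulo \<open>m\<close> and let
  \<open>j\<close> absorb the quotient. As \<open>k\<close> and \<open>i * n\<close> both lie
  between 0 and \<open>n * m\<close>, so does \<open>j * m\<close> in absolute value.\<close>

lemma bounded_combination:
  assumes "n > 0" "m > 0" "coprime n m" "k \<le> n * m"
  obtains i j where "i < m" "\<bar>j\<bar> \<le> int n" "int k = int i * int n + j * int m"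
proof -
  have "coprime (int n) (int m)" using assms(3) by simp
  then obtain u v where uv: "u * int n + v * int m = 1"
    using bezout_int[of "int n" "int m"] by auto
  define r where "r = (u * int k) mod int m"
  define j where "j = v * int k + (u * int k) div int m * int n"
  have "u * int k = (u * int k) div int m * int m + r" by (simp add: r_def)
  then have "r = u * int k - (u * int k) div int m * int m" by simp
  then have "r * int n = (u * int k - (u * int k) div int m * int m) * int n" by (rule arg_cong)
  then have "r * int n + j * int m = (u * int n + v * int m) * int k"
    by (simp add: j_def algebra_simps)
  then have k: "int k = r * int n + j * int m" using uv by simp
  have r: "0 \<le> r" "r < int m" using assms(2) by (simp_all add: r_def)
  have "int k \<le> int n * int m" using assms(4) by (metis of_nat_le_iff of_nat_mult)
  then have "j * int m \<le> int n * int m" using k r by (smt (verit) mult_nonneg_nonneg of_nat_0_le_iff)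
  then have "j \<le> int n" using assms(2) by simp
  moreover have "r * int n \<le> int m * int n" using r by (intro mult_right_mono) auto
  then have "(- int n) * int m \<le> j * int m" using k by (simp add: algebra_simps)
  then have "- int n \<le> j" using assms(2) by (subst (asm) mult_le_cancel_right) simp
  ultimately show ?thesis using that[of "nat r" j] k r by auto
qed

lemma LD_eq_Gamma:
  assumes "n > 0" "coprime n (n + p)"
  shows "LD n p = {(zcos (n + p) (i * n + j * (n + p)), zcos n (i * n + j * (n + p))) | i j.
                  (i, j) \<in> Gamma_idx_L n p}" (is "_ = ?G")
proof (intro Set.equalityI subsetI)
  fix q assume "q \<in> ?G"
  then show "q \<in> LD n p"
    using icos_pair_in_LD[OF assms(1)] by (auto simp: zcos_eq_icos)
next
  let ?m = "n + p"
  let ?pt = "\<lambda>i j. (zcos ?m (i * n + j * ?m), zcos n (i * n + j * ?m))"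
  fix q assume "q \<in> LD n p"
  then obtain k where q: "q = (zcos ?m k, zcos n k)" and k: "k \<le> n * ?m"
    using LD_eq[OF assms(1)] by blast
  obtain i j0 where i: "i < ?m" and j0: "\<bar>j0\<bar> \<le> int n" and kij: "int k = int i * int n + j0 * int ?m"
    using bounded_combination[OF assms(1) _ assms(2) k] assms(1) by auto
  define j where "j = nat \<bar>j0\<bar>"
  have j: "j \<le> n" using j0 by (simp add: j_def)
  have "j0 = int j \<or> j0 = - int j" by (auto simp: j_def)
  then have qij: "q = ?pt i j"
  proof
    assume "j0 = - int j"
    then have k': "int k = int i * int n - int j * int ?m" using kij by simp
    have "int k - int (i * n + j * ?m) = 2 * int ?m * (- int j)"
      "int k + int (i * n + j * ?m) = 2 * int n * int i" unfolding k' by (simp_all add: algebra_simps)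
    then have "2 * int ?m dvd int k - int (i * n + j * ?m)" "2 * int n dvd int k + int (i * n + j * ?m)"
      by (metis dvd_triv_left)+
    then show ?thesis
      unfolding q zcos_eq_icos using assms(1) by (simp only: icos_eq_iff add_gr_0 prod.inject simp_thms)
  qed (use kij q in \<open>simp flip: of_nat_mult of_nat_add\<close>)
  consider "i * n + j * ?m < n * ?m" | "i * n + j * ?m = n * ?m" | "n * ?m < i * n + j * ?m"
    by linarith
  then show "q \<in> ?G"
  proof cases
    case 1
    then have "(i, j) \<in> Gamma_idx_L n p" using Gamma_idx_iff[OF assms(1)] by (simp add: Gamma_idx_L_def)
    then show ?thesis using qij by blast
  next
    case 2
    \<comment> \<open>Equality forces \<open>n + p\<close> to divide \<open>i < n + p\<close>, which
      leaves only the extra pair \<open>(0, n)\<close>.\<close>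
    then have "?m dvd i * n + j * ?m" by simp
    then have "?m dvd i * n" using dvd_add_left_iff[of ?m "j * ?m" "i * n"] by simp
    then have "?m dvd i" using assms(2)
      by (metis coprime_commute coprime_dvd_mult_left_iff)
    then have "i = 0" using i by (metis dvd_imp_le leD neq0_conv)
    then have "j = n" using 2 assms(1) by simp
    then have "(i, j) \<in> Gamma_idx_L n p" using \<open>i = 0\<close> by (simp add: Gamma_idx_L_def)
    then show ?thesis using qij by blast
  next
    case 3
    \<comment> \<open>The old and new node indices add up to \<open>2 * n * (n + p)\<close>: they
      are negatives of each other modulo both periods, and the new one falls below
      \<open>n * (n + p)\<close>.\<close>
    let ?i = "?m - i" and ?j = "n - j"
    have "int ?i = int ?m - int i" "int ?j = int n - int j" using i j by auto
    then have sum: "int (?i * n + ?j * ?m) = 2 * int (n * ?m) - int (i * n + j * ?m)"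
      by (simp only: of_nat_add of_nat_mult) (simp add: algebra_simps)
    have "int (?i * n + ?j * ?m) < int (n * ?m)" unfolding sum using 3 by linarith
    then have "(?i, ?j) \<in> Gamma_idx_L n p"
      using Gamma_idx_iff[OF assms(1)] by (simp only: of_nat_less_iff Gamma_idx_L_def Un_iff simp_thms)
    moreover have "q = ?pt ?i ?j"
    proof -
      have "int (i * n + j * ?m) + int (?i * n + ?j * ?m) = 2 * int n * int ?m"
        "2 * int n * int ?m = 2 * int ?m * int n"
        unfolding sum by simp_all
      then have "2 * int ?m dvd int (i * n + j * ?m) + int (?i * n + ?j * ?m)"
        "2 * int n dvd int (i * n + j * ?m) + int (?i * n + ?j * ?m)"
        by (metis dvd_triv_left)+
      then show ?thesis
        unfolding qij zcos_eq_icos using assms(1) by (simp only: icos_eq_iff add_gr_0 prod.inject simp_thms)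
    qed
    ultimately show ?thesis by blast
  qed
qed

theorem proposition2:
  fixes n p :: nat
  assumes "n > 0" and "p > 0" and "coprime n (n + p)"
  shows "real (card (LD n p)) = real ((n + p + 1) * (n + 1)) / 2
    \<and> LD n p = self_intersection_points n p \<union> boundary_points n p
    \<and> LD n p = LD_int n p \<union> LD_out n p
    \<and> LD n p = {(zcos (n + p) i, zcos n j) | i j. i \<le> n + p \<and> j \<le> n \<and> even (i + j)}
    \<and> LD n p = LD_b n p \<union> LD_w n p
    \<and> LD n p = {(zcos (n + p) (i * n + j * (n + p)), zcos n (i * n + j * (n + p))) | i j.
                  (i, j) \<in> Gamma_idx_L n p}"
proof (intro conjI)
  note LD = LD_eq_nodes[OF assms(1,3)]
  show "real (card (LD n p)) = real ((n + p + 1) * (n + 1)) / 2"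
    unfolding LD using card_nodes[OF assms(1) _ assms(3)] assms(1) by simp
  show "LD n p = self_intersection_points n p \<union> boundary_points n p"
    by (rule LD_eq_self_intersection_boundary[OF assms(1,3)])
  show "LD n p = LD_int n p \<union> LD_out n p"
    unfolding LD by (rule nodes_eq_LD_int_out[OF assms(1)])
  show "LD n p = {(zcos (n + p) i, zcos n j) | i j. i \<le> n + p \<and> j \<le> n \<and> even (i + j)}"
    using LD by (simp only: nodes_def)
  show "LD n p = LD_b n p \<union> LD_w n p"
    unfolding LD by (rule nodes_eq_LD_b_w)
qed (rule LD_eq_Gamma[OF assms(1,3)])

end
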